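(* Let $\Gamma$ be the complete graph with $d+1$ vertices, let $\rho$ be a nonincreasing function, and let $u:\Gamma\times\mathbf{R}\to\mathbf{R}$ satisfy $$\partial_t u(v,t)=\frac1d\sum_{\tilde v\ne v}[u(\tilde v,t)-u(v,t)]\,\rho(|u(\tilde v,t)-u(v,t)|).$$ If $\rho(s)\ge s^{-\alpha}$ for $0<\alpha<2$ and $u(\cdot,t)$ is not constant for some $t>0$, then $$\mathrm{Var}_{u(\cdot,t)}^{\frac{\alpha}{2}}\le\mathrm{Var}_{u(\cdot,0)}^{\frac{\alpha}{2}}-c_{d,\alpha}\,t,$$ where $$c_{d,\alpha}=\begin{cases}\dfrac{\alpha\,(d+1)^{\frac{4-3\alpha}{2}}}{2\,d^{2-\alpha}}&\text{if }0<\alpha\le1,\\[2mm]\dfrac{\alpha\,(d+1)^{\frac{4-3\alpha}{2}}}{2\,d}&\text{if }1<\alpha<2.\end{cases}$$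
   Context: For $w:\Gamma\to\mathbf{R}$, $\mathcal{A}_w=\frac1{d+1}\sum_{v}w(v)$ and $\mathrm{Var}_w=\frac{1}{d+1}\sum_v|w(v)-\mathcal{A}_w|^2$. Time is continuous and $\partial_t$ is the ordinary time derivative. The bound $\rho(s)\ge s^{-\alpha}$ is for all $s>0$. *)

theory Defs
  imports "HOL-Analysis.Analysis" "Graph_Theory.Kuratowski"
begin

definition mean :: "'v set \<Rightarrow> ('v \<Rightarrow> real) \<Rightarrow> real" where
  "mean V w = (\<Sum>v\<in>V. w v) / real (card V)"

definition Var :: "'v set \<Rightarrow> ('v \<Rightarrow> real) \<Rightarrow> real" where
  "Var V w = (\<Sum>v\<in>V. \<bar>w v - mean V w\<bar>\<^sup>2) / real (card V)"

(* T is the time interval on which the equation holds. For T = UNIV the derivative is the ordinary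
   one at every real time; at an end point belonging to T it is the one-sided one. General
   intervals matter: with rho(s) >= s powr (-alpha) and alpha >= 1, distinct values are driven
   together in finite time and the equation fails at that time, so that for T = UNIV only
   constant solutions remain.
   The value rho 0 is irrelevant: it is always multiplied by 0. *)
definition solves_on ::
  "real set \<Rightarrow> nat \<Rightarrow> 'v set \<Rightarrow> (real \<Rightarrow> real) \<Rightarrow> ('v \<Rightarrow> real \<Rightarrow> real) \<Rightarrow> bool" where
  "solves_on T d V \<rho> u \<longleftrightarrow>
     (\<forall>v\<in>V. \<forall>s\<in>T.
        (u v has_real_derivative
           (1 / real d) * (\<Sum>v'\<in>V - {v}. (u v' s - u v s) * \<rho> \<bar>u v' s - u v s\<bar>))
        (at s within T))"

definition decay_const :: "nat \<Rightarrow> real \<Rightarrow> real" where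
  "decay_const d \<alpha> =
     (if \<alpha> \<le> 1
      then \<alpha> * (real d + 1) powr ((4 - 3 * \<alpha>) / 2) / (2 * real d powr (2 - \<alpha>))
      else \<alpha> * (real d + 1) powr ((4 - 3 * \<alpha>) / 2) / (2 * real d))"

end

theory Submission
  imports Defs
begin

text \<open>Symmetrising the equation gives
  \<open>Var' = - (1 / (d (d + 1))) \<Sum>\<^sub>v \<Sum>\<^sub>w |u v - u w|\<^sup>2 \<rho> |u v - u w|\<close>,
  so \<open>Var\<close> is nonincreasing and is positive on \<open>[0, t]\<close> when it is positive at \<open>t\<close>. With
  \<open>\<beta> = 2 - \<alpha>\<close> the summands are at least \<open>|u v - u w|\<^sup>\<beta>\<close>. For fixed \<open>v\<close> the sum over \<open>w\<close> of
  these powers is compared with the \<open>\<beta>\<close>-th power of \<open>\<Sum>\<^sub>w |u v - u w| \<ge> (d + 1) |u v - mean|\<close>,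
  by subadditivity of the power if \<open>\<beta> \<le> 1\<close> and by convexity if \<open>\<beta> \<ge> 1\<close>; this is the origin of the
  two cases of the constant. Subadditivity with exponent \<open>\<beta> / 2\<close> in the sum over \<open>v\<close> then gives
  \<open>Var' \<le> - (2 / \<alpha>) c Var powr (1 - \<alpha> / 2)\<close>.\<close>

text \<open>Divided by the total, every term lies in \<open>[0, 1]\<close>, where raising to a power
  \<open>p \<le> 1\<close> cannot decrease it, while the divided terms add up to 1.\<close>

lemma powr_sum_le_sum_powr:
  fixes x :: "'a \<Rightarrow> real"
  assumes "finite A" "\<And>i. i \<in> A \<Longrightarrow> 0 \<le> x i" "0 < p" "p \<le> 1"
  shows "(\<Sum>i\<in>A. x i) powr p \<le> (\<Sum>i\<in>A. x i powr p)"
proof (cases "(\<Sum>i\<in>A. x i) = 0")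
  case True
  then show ?thesis by (simp add: sum_nonneg)
next
  case False
  define S where "S = (\<Sum>i\<in>A. x i)"
  have S: "S > 0" using False assms(2) sum_nonneg[of A x] unfolding S_def by fastforce
  have le: "x i / S \<le> x i powr p / S powr p" if "i \<in> A" for i
  proof -
    have "x i \<le> S" unfolding S_def using assms that by (intro member_le_sum) auto
    then have "x i / S \<le> 1" "0 \<le> x i / S" using S assms(2)[OF that] by auto
    then have "(x i / S) powr 1 \<le> (x i / S) powr p"
      using assms by (intro powr_mono') auto
    then show ?thesis using S assms(2)[OF that] by (simp add: powr_divide)
  qed
  have "1 = (\<Sum>i\<in>A. x i / S)" using S by (simp add: S_def flip: sum_divide_distrib)
  also have "\<dots> \<le> (\<Sum>i\<in>A. x i powr p / S powr p)" by (intro sum_mono le)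
  also have "\<dots> = (\<Sum>i\<in>A. x i powr p) / S powr p" by (simp add: sum_divide_distrib)
  finally show ?thesis using S by (simp add: S_def field_simps)
qed

text \<open>Jensen's inequality for \<open>x powr p\<close> with equal weights, multiplied
  out.\<close>

lemma powr_sum_le_card_sum_powr:
  fixes x :: "'a \<Rightarrow> real"
  assumes "finite A" "\<And>i. i \<in> A \<Longrightarrow> 0 \<le> x i" "1 \<le> p"
  shows "(\<Sum>i\<in>A. x i) powr p \<le> real (card A) powr (p - 1) * (\<Sum>i\<in>A. x i powr p)"
proof (cases "{i \<in> A. x i > 0} = {}")
  case True
  then have "\<And>i. i \<in> A \<Longrightarrow> x i = 0" using assms(2) by force
  then show ?thesis by simp
next
  case False
  \<comment> \<open>Convexity of the power is used on the open half-line \<open>{0<..}\<close>, so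
    the zero terms are discarded first; they contribute nothing to either sum.\<close>
  define B where "B = {i \<in> A. x i > 0}"
  have B: "finite B" "B \<noteq> {}" "B \<subseteq> A" using False assms(1) by (auto simp: B_def)
  define k where "k = real (card B)"
  have k: "k > 0" "k \<le> real (card A)"
    using B assms(1) by (auto simp: k_def card_gt_0_iff intro: card_mono)
  have eq: "(\<Sum>i\<in>A. x i) = (\<Sum>i\<in>B. x i)" "(\<Sum>i\<in>A. x i powr p) = (\<Sum>i\<in>B. x i powr p)"
    using assms by (auto intro!: sum.mono_neutral_right simp: B_def) force+
  have "(\<Sum>i\<in>B. (1 / k) *\<^sub>R x i) powr p \<le> (\<Sum>i\<in>B. (1 / k) * (x i powr p))"
    using B k powr_convex[OF assms(3)]
    by (intro convex_on_sum[where C = "{0<..}"]) (auto simp: k_def B_def)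
  then have "((\<Sum>i\<in>B. x i) / k) powr p \<le> (\<Sum>i\<in>B. x i powr p) / k"
    by (simp flip: sum_divide_distrib)
  moreover have "0 \<le> (\<Sum>i\<in>B. x i)" by (intro sum_nonneg) (auto simp: B_def)
  ultimately have "(\<Sum>i\<in>B. x i) powr p \<le> k powr (p - 1) * (\<Sum>i\<in>B. x i powr p)"
    using k by (simp add: powr_divide powr_diff field_simps)
  \<comment> \<open>Passing from \<open>card B\<close> to \<open>card A\<close> only weakens the
    bound, as \<open>p - 1\<close> is nonnegative.\<close>
  also have "\<dots> \<le> real (card A) powr (p - 1) * (\<Sum>i\<in>B. x i powr p)"
    using k assms(3) by (intro mult_right_mono powr_mono2 sum_nonneg) auto
  finally show ?thesis by (simp add: eq)
qed

lemma Var_nonneg: "0 \<le> Var V w"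
  by (simp add: Var_def sum_nonneg)

lemma Var_pos:
  assumes "finite V" "\<not> w constant_on V"
  shows "0 < Var V w"
proof -
  obtain v where v: "v \<in> V" "w v \<noteq> mean V w"
    using assms(2) by (auto simp: constant_on_def)
  then have "0 < (\<Sum>v\<in>V. \<bar>w v - mean V w\<bar>\<^sup>2)"
    using assms(1) by (intro sum_pos2[of V v]) auto
  moreover have "card V > 0" using v assms(1) by (auto simp: card_gt_0_iff)
  ultimately show ?thesis by (simp add: Var_def)
qed

lemma Var_has_real_derivative:
  fixes u :: "'v \<Rightarrow> real \<Rightarrow> real"
  assumes "\<And>v. v \<in> V \<Longrightarrow> (u v has_real_derivative u' v) (at s within T)"
  shows "((\<lambda>s. Var V (\<lambda>v. u v s)) has_real_derivative
           2 / real (card V) * (\<Sum>v\<in>V. (u v s - mean V (\<lambda>v. u v s)) * u' v)) (at s within T)"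
proof -
  define m' where "m' = (\<Sum>v\<in>V. u' v) / real (card V)"
  have m: "((\<lambda>s. mean V (\<lambda>v. u v s)) has_real_derivative m') (at s within T)"
    unfolding mean_def m'_def by (intro DERIV_cdivide DERIV_sum assms)
  \<comment> \<open>This removes the derivative of the mean from the result. If
    \<open>card V = 0\<close>, then \<open>V\<close> is empty or infinite and the sum is 0 in both
    cases.\<close>
  have z: "(\<Sum>v\<in>V. u v s - mean V (\<lambda>v. u v s)) = 0"
    by (cases "card V = 0") (auto simp: mean_def sum_subtractf card_eq_0_iff)
  have "((\<lambda>s. Var V (\<lambda>v. u v s)) has_real_derivative
      (\<Sum>v\<in>V. 2 * (u v s - mean V (\<lambda>v. u v s)) * (u' v - m')) / real (card V)) (at s within T)"
    unfolding Var_def power2_abs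
    by (intro DERIV_cdivide DERIV_sum) (auto intro!: derivative_eq_intros assms m)
  also have "(\<Sum>v\<in>V. 2 * (u v s - mean V (\<lambda>v. u v s)) * (u' v - m')) =
      2 * (\<Sum>v\<in>V. (u v s - mean V (\<lambda>v. u v s)) * u' v)
        - 2 * m' * (\<Sum>v\<in>V. u v s - mean V (\<lambda>v. u v s))"
    by (simp add: sum_distrib_left sum_subtractf[symmetric] algebra_simps)
  finally show ?thesis by (simp add: z)
qed

text \<open>The interaction is antisymmetric in \<open>v\<close> and \<open>v'\<close>, so averaging
  the double sum with its transpose cancels any constant \<open>a\<close>; the mean is the case of
  interest.\<close>

lemma sum_mult_differences:
  fixes w :: "'v \<Rightarrow> real" and \<rho> :: "real \<Rightarrow> real"
  assumes "finite V"
  shows "2 * (\<Sum>v\<in>V. (w v - a) * (\<Sum>v'\<in>V - {v}. (w v' - w v) * \<rho> \<bar>w v' - w v\<bar>)) =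
    - (\<Sum>v\<in>V. \<Sum>v'\<in>V. \<bar>w v - w v'\<bar>\<^sup>2 * \<rho> \<bar>w v - w v'\<bar>)"
proof -
  \<comment> \<open>Since \<open>g v v\<close> is 0, the inner sums may run over all of
    \<open>V\<close>, which makes the swap possible.\<close>
  define g where "g v v' = (w v - a) * ((w v' - w v) * \<rho> \<bar>w v' - w v\<bar>)" for v v'
  have "(\<Sum>v\<in>V. (w v - a) * (\<Sum>v'\<in>V - {v}. (w v' - w v) * \<rho> \<bar>w v' - w v\<bar>)) =
      (\<Sum>v\<in>V. \<Sum>v'\<in>V. g v v')" (is "?L = _")
    using assms by (intro sum.cong) (auto simp: g_def sum_distrib_left sum.remove[where A = V])
  moreover have "(\<Sum>v\<in>V. \<Sum>v'\<in>V. g v v') = (\<Sum>v\<in>V. \<Sum>v'\<in>V. g v' v)"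
    by (rule sum.swap)
  ultimately have "2 * ?L = (\<Sum>v\<in>V. \<Sum>v'\<in>V. g v v' + g v' v)"
    by (simp add: sum.distrib)
  also have "\<dots> = (\<Sum>v\<in>V. \<Sum>v'\<in>V. - (\<bar>w v - w v'\<bar>\<^sup>2 * \<rho> \<bar>w v - w v'\<bar>))"
    by (intro sum.cong refl)
       (simp add: g_def abs_minus_commute power2_eq_square algebra_simps)
  finally show ?thesis by (simp add: sum_negf)
qed

text \<open>The exponent \<open>3 * \<beta> / 2\<close> collects \<open>\<beta>\<close> from the
  factor \<open>d + 1\<close> in front of each deviation from the mean and
  \<open>\<beta> / 2\<close> from the normalisation of \<open>Var\<close>.\<close>

lemma sum_sum_powr_ge_Var:
  fixes w :: "'v \<Rightarrow> real"
  assumes V: "finite V" "card V = d + 1" and "0 < d" and \<beta>: "0 < \<beta>" "\<beta> \<le> 2"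
  defines "K \<equiv> (if 1 \<le> \<beta> then real d powr (1 - \<beta>) else 1)"
  shows "K * (real d + 1) powr (3 * \<beta> / 2) * Var V w powr (\<beta> / 2)
           \<le> (\<Sum>v\<in>V. \<Sum>v'\<in>V. \<bar>w v - w v'\<bar> powr \<beta>)"
proof -
  define n where "n = real d + 1"
  have n: "n > 0" "real (card V) = n" by (auto simp: n_def V)
  have K: "K > 0" using \<open>0 < d\<close> by (simp add: K_def)
  have row: "K * (n powr \<beta> * \<bar>w v - mean V w\<bar> powr \<beta>) \<le> (\<Sum>v'\<in>V. \<bar>w v - w v'\<bar> powr \<beta>)"
    if v: "v \<in> V" for v
  proof -
    have "n * (w v - mean V w) = (\<Sum>v'\<in>V. w v - w v')"
      using n by (simp add: mean_def sum_subtractf algebra_simps)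
    then have "n * \<bar>w v - mean V w\<bar> = \<bar>\<Sum>v'\<in>V. w v - w v'\<bar>"
      using n by (metis abs_mult abs_of_pos)
    also have "\<dots> \<le> (\<Sum>v'\<in>V. \<bar>w v - w v'\<bar>)" by (rule sum_abs)
    \<comment> \<open>Dropping the vanishing diagonal term leaves \<open>d\<close> summands, so the
      convexity bound costs a power of \<open>d\<close> and not of \<open>d + 1\<close>.\<close>
    also have "\<dots> = (\<Sum>v'\<in>V - {v}. \<bar>w v - w v'\<bar>)"
      using V v by (simp add: sum.remove)
    finally have "(n * \<bar>w v - mean V w\<bar>) powr \<beta> \<le> (\<Sum>v'\<in>V - {v}. \<bar>w v - w v'\<bar>) powr \<beta>"
      using n \<beta> by (intro powr_mono2) auto
    then have *: "n powr \<beta> * \<bar>w v - mean V w\<bar> powr \<beta> \<le> (\<Sum>v'\<in>V - {v}. \<bar>w v - w v'\<bar>) powr \<beta>"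
      using n by (simp add: powr_mult)
    have "K * (\<Sum>v'\<in>V - {v}. \<bar>w v - w v'\<bar>) powr \<beta> \<le> (\<Sum>v'\<in>V - {v}. \<bar>w v - w v'\<bar> powr \<beta>)"
    proof (cases "1 \<le> \<beta>")
      case True
      have "(\<Sum>v'\<in>V - {v}. \<bar>w v - w v'\<bar>) powr \<beta>
          \<le> real d powr (\<beta> - 1) * (\<Sum>v'\<in>V - {v}. \<bar>w v - w v'\<bar> powr \<beta>)"
        using powr_sum_le_card_sum_powr[of "V - {v}" "\<lambda>v'. \<bar>w v - w v'\<bar>" \<beta>] V v True by simp
      then show ?thesis using True \<open>0 < d\<close> by (simp add: K_def powr_diff field_simps)
    next
      case False
      then show ?thesis using V \<beta> by (simp add: K_def powr_sum_le_sum_powr)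
    qed
    also have "\<dots> = (\<Sum>v'\<in>V. \<bar>w v - w v'\<bar> powr \<beta>)"
      using V v by (simp add: sum.remove)
    finally show ?thesis using * K by (meson mult_left_mono less_imp_le order_trans)
  qed
  have "n powr (\<beta> / 2) * Var V w powr (\<beta> / 2) = (\<Sum>v\<in>V. \<bar>w v - mean V w\<bar>\<^sup>2) powr (\<beta> / 2)"
    using n by (simp add: Var_nonneg Var_def sum_nonneg flip: powr_mult)
  also have "\<dots> \<le> (\<Sum>v\<in>V. (\<bar>w v - mean V w\<bar>\<^sup>2) powr (\<beta> / 2))"
    using V \<beta> by (intro powr_sum_le_sum_powr) auto
  also have "\<dots> = (\<Sum>v\<in>V. \<bar>w v - mean V w\<bar> powr \<beta>)"
  proof (intro sum.cong refl)
    fix v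
    show "(\<bar>w v - mean V w\<bar>\<^sup>2) powr (\<beta> / 2) = \<bar>w v - mean V w\<bar> powr \<beta>"
      by (cases "w v = mean V w") (simp_all add: powr_powr flip: powr_numeral del: power2_abs)
  qed
  finally have "K * n powr \<beta> * (n powr (\<beta> / 2) * Var V w powr (\<beta> / 2))
      \<le> K * n powr \<beta> * (\<Sum>v\<in>V. \<bar>w v - mean V w\<bar> powr \<beta>)"
    using K by (intro mult_left_mono) auto
  also have "\<dots> = (\<Sum>v\<in>V. K * (n powr \<beta> * \<bar>w v - mean V w\<bar> powr \<beta>))"
    by (simp add: sum_distrib_left mult.assoc)
  also have "\<dots> \<le> (\<Sum>v\<in>V. \<Sum>v'\<in>V. \<bar>w v - w v'\<bar> powr \<beta>)"
    by (intro sum_mono row)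
  finally have "K * (n powr \<beta> * n powr (\<beta> / 2)) * Var V w powr (\<beta> / 2)
      \<le> (\<Sum>v\<in>V. \<Sum>v'\<in>V. \<bar>w v - w v'\<bar> powr \<beta>)"
    by (simp add: mult_ac)
  then show ?thesis by (simp add: n_def flip: powr_add)
qed

text \<open>The left-hand side is the derivative of \<open>Var\<close> along the equation, with
  \<open>w\<close> the state at one time.\<close>

lemma Var_derivative_le:
  fixes w :: "'v \<Rightarrow> real"
  assumes V: "finite V" "card V = d + 1" and "0 < d" and \<alpha>: "0 < \<alpha>" "\<alpha> < 2"
    and \<rho>: "\<And>s. 0 < s \<Longrightarrow> s powr (- \<alpha>) \<le> \<rho> s"
  shows "2 / real (card V) * (\<Sum>v\<in>V. (w v - mean V w) *
             (1 / real d * (\<Sum>v'\<in>V - {v}. (w v' - w v) * \<rho> \<bar>w v' - w v\<bar>)))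
           \<le> - (2 / \<alpha> * decay_const d \<alpha> * Var V w powr (1 - \<alpha> / 2))" (is "?L \<le> _")
proof -
  define n where "n = real d + 1"
  have n: "n > 0" "real (card V) = n" by (auto simp: n_def V)
  define K where "K = (if 1 \<le> 2 - \<alpha> then real d powr (1 - (2 - \<alpha>)) else 1)"
  \<comment> \<open>The lower bound on \<open>\<rho>\<close> is available only at positive
    arguments; for equal values both sides are 0.\<close>
  have pt: "\<bar>w v - w v'\<bar> powr (2 - \<alpha>) \<le> \<bar>w v - w v'\<bar>\<^sup>2 * \<rho> \<bar>w v - w v'\<bar>" for v v'
  proof (cases "w v = w v'")
    case False
    then have pos: "0 < \<bar>w v - w v'\<bar>" by simp
    have "\<bar>w v - w v'\<bar> powr (2 - \<alpha>) = \<bar>w v - w v'\<bar>\<^sup>2 * \<bar>w v - w v'\<bar> powr (- \<alpha>)"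
      using pos by (simp add: powr_diff powr_minus divide_inverse)
    also have "\<dots> \<le> \<bar>w v - w v'\<bar>\<^sup>2 * \<rho> \<bar>w v - w v'\<bar>"
      using \<rho>[OF pos] by (intro mult_left_mono) auto
    finally show ?thesis .
  qed simp
  have "2 / \<alpha> * decay_const d \<alpha> = K * n powr ((4 - 3 * \<alpha>) / 2) / real d"
    using \<alpha> \<open>0 < d\<close>
    by (simp add: decay_const_def K_def n_def powr_diff powr_minus field_simps power2_eq_square)
  \<comment> \<open>The lost unit in the exponent is the factor \<open>1 / (d + 1)\<close> in the
    definition of \<open>Var\<close>.\<close>
  also have "(4 - 3 * \<alpha>) / 2 = 3 * (2 - \<alpha>) / 2 - 1" by simp
  also have "n powr \<dots> = n powr (3 * (2 - \<alpha>) / 2) / n"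
    using n by (simp add: powr_diff)
  finally have c: "2 / \<alpha> * decay_const d \<alpha> = K * n powr (3 * (2 - \<alpha>) / 2) / (n * real d)"
    by simp
  have "K * n powr (3 * (2 - \<alpha>) / 2) * Var V w powr ((2 - \<alpha>) / 2)
      \<le> (\<Sum>v\<in>V. \<Sum>v'\<in>V. \<bar>w v - w v'\<bar> powr (2 - \<alpha>))"
    unfolding K_def n_def using assms by (intro sum_sum_powr_ge_Var) auto
  also have "\<dots> \<le> (\<Sum>v\<in>V. \<Sum>v'\<in>V. \<bar>w v - w v'\<bar>\<^sup>2 * \<rho> \<bar>w v - w v'\<bar>)" (is "_ \<le> ?R")
    by (intro sum_mono pt)
  finally have "2 / \<alpha> * decay_const d \<alpha> * Var V w powr ((2 - \<alpha>) / 2) \<le> ?R / (n * real d)"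
    using n \<open>0 < d\<close> divide_right_mono[of _ ?R "n * real d"] unfolding c by simp
  moreover have "(2 - \<alpha>) / 2 = 1 - \<alpha> / 2" by (simp add: field_simps)
  moreover have "?L = 2 * (\<Sum>v\<in>V. (w v - mean V w) *
      (\<Sum>v'\<in>V - {v}. (w v' - w v) * \<rho> \<bar>w v' - w v\<bar>)) / (n * real d)"
    by (simp add: n sum_distrib_left sum_divide_distrib mult_ac)
  ultimately show ?thesis
    by (simp add: sum_mult_differences[OF V(1)])
qed

text \<open>By the chain rule the derivative of \<open>f s powr a\<close> is
  \<open>a * f s powr (a - 1) * f' s\<close>, where the powers of \<open>f s\<close> cancel against
  the bound and leave at most \<open>- c\<close>.\<close>

lemma powr_decay_of_derivative_le:
  fixes f f' :: "real \<Rightarrow> real"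
  assumes "0 \<le> t" and deriv: "\<And>s. s \<in> {0..t} \<Longrightarrow> (f has_real_derivative f' s) (at s within {0..t})"
    and le: "\<And>s. s \<in> {0..t} \<Longrightarrow> f' s \<le> - (c / a * f s powr (1 - a))"
    and "0 < a" "0 \<le> c" "0 < f t"
  shows "f t powr a \<le> f 0 powr a - c * t"
proof -
  have cont: "continuous_on {0..t} f"
    using deriv DERIV_continuous_on by blast
  have int: "(f has_real_derivative f' s) (at s)" if "0 < s" "s < t" for s
    using deriv[of s] that by (simp add: at_within_Icc_at)
  \<comment> \<open>The chain rule for \<open>powr\<close> needs a positive base. Positivity is
    carried back from time \<open>t\<close>, because \<open>f' \<le> 0\<close> makes
    \<open>f\<close> nonincreasing.\<close>
  have pos: "0 < f s" if s: "s \<in> {0..t}" for s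
  proof -
    have "f t \<le> f s"
    proof (rule DERIV_nonpos_imp_decreasing_open[where f = f])
      fix x assume x: "s < x" "x < t"
      have "0 \<le> c / a * f x powr (1 - a)" using assms by simp
      then show "\<exists>y. DERIV f x :> y \<and> y \<le> 0"
        using int[of x] le[of x] x s by (intro exI[of _ "f' x"]) auto
    qed (use s in \<open>auto intro: continuous_on_subset[OF cont]\<close>)
    then show ?thesis using \<open>0 < f t\<close> by simp
  qed
  have "f t powr a + c * t \<le> f 0 powr a + c * 0"
  proof (rule DERIV_nonpos_imp_decreasing_open[where f = "\<lambda>s. f s powr a + c * s"])
    show "continuous_on {0..t} (\<lambda>s. f s powr a + c * s)"
      using pos by (intro continuous_intros cont) force
  next
    fix x assume x: "0 < x" "x < t"
    then have p: "0 < f x" using pos by simp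
    have "((\<lambda>s. f s powr a + c * s) has_real_derivative a * f x powr (a - 1) * f' x + c) (at x)"
      using DERIV_add[OF DERIV_fun_powr[OF int[OF x] p, of a] DERIV_cmult_Id[of c]] by simp
    moreover have "a * f x powr (a - 1) * f' x \<le> a * f x powr (a - 1) * - (c / a * f x powr (1 - a))"
      using le[of x] x \<open>0 < a\<close> by (intro mult_left_mono) auto
    moreover have "\<dots> = - c"
      using p \<open>0 < a\<close> by (simp add: powr_diff)
    ultimately show "\<exists>y. ((\<lambda>s. f s powr a + c * s) has_real_derivative y) (at x) \<and> y \<le> 0"
      by (intro exI[of _ "a * f x powr (a - 1) * f' x + c"]) auto
  qed (use assms in auto)
  then show ?thesis by simp
qed

theorem corollary10p8:
  fixes G :: "('v, 'e) pre_digraph"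
    and d :: nat
    and \<rho> :: "real \<Rightarrow> real"
    and u :: "'v \<Rightarrow> real \<Rightarrow> real"
    and \<alpha> t :: real
    and T :: "real set"
  assumes "complete_digraph (d + 1) G"
    and "antimono_on {0<..} \<rho>"
    and "is_interval T" and "{0..t} \<subseteq> T"
    and "solves_on T d (verts G) \<rho> u"
    and "0 < \<alpha>" and "\<alpha> < 2"
    and "\<And>s. 0 < s \<Longrightarrow> s powr (- \<alpha>) \<le> \<rho> s"
    and "0 < t"
    and "\<not> (\<lambda>v. u v t) constant_on verts G"
  shows "Var (verts G) (\<lambda>v. u v t) powr (\<alpha> / 2)
           \<le> Var (verts G) (\<lambda>v. u v 0) powr (\<alpha> / 2) - decay_const d \<alpha> * t"
proof -
  have V: "finite (verts G)" "card (verts G) = d + 1"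
    using assms(1) by (auto simp: complete_digraph_def intro: card_ge_0_finite)
  \<comment> \<open>On a single vertex every function is constant.\<close>
  have "d \<noteq> 0"
  proof
    assume "d = 0"
    then obtain v where "verts G = {v}" using V by (auto simp: card_1_singleton_iff)
    then show False using assms(10) by (auto simp: constant_on_def)
  qed
  then have d: "0 < d" by simp
  let ?u' = "\<lambda>v s. 1 / real d * (\<Sum>v'\<in>verts G - {v}. (u v' s - u v s) * \<rho> \<bar>u v' s - u v s\<bar>)"
  have "(u v has_real_derivative ?u' v s) (at s within {0..t})"
    if "v \<in> verts G" "s \<in> {0..t}" for v s
    using assms(4,5) that unfolding solves_on_def
    by (intro has_field_derivative_subset[of "u v" _ s T "{0..t}"]) auto
  then have deriv: "((\<lambda>s. Var (verts G) (\<lambda>v. u v s)) has_real_derivative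
      2 / real (card (verts G)) * (\<Sum>v\<in>verts G. (u v s - mean (verts G) (\<lambda>v. u v s)) * ?u' v s))
      (at s within {0..t})" if "s \<in> {0..t}" for s
    using that by (intro Var_has_real_derivative) blast
  show ?thesis
  \<comment> \<open>Applied with \<open>a = \<alpha> / 2\<close> and
    \<open>c = decay_const d \<alpha>\<close>, so that \<open>c / a\<close> is the factor
    \<open>2 / \<alpha> * decay_const d \<alpha>\<close> of the variance estimate.\<close>
  proof (rule powr_decay_of_derivative_le[OF _ deriv])
    show "0 \<le> decay_const d \<alpha>" using assms(6) by (simp add: decay_const_def)
    show "0 < Var (verts G) (\<lambda>v. u v t)" using Var_pos[OF V(1) assms(10)] .
    show "2 / real (card (verts G)) *
        (\<Sum>v\<in>verts G. (u v s - mean (verts G) (\<lambda>v. u v s)) * ?u' v s)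
        \<le> - (decay_const d \<alpha> / (\<alpha> / 2) * Var (verts G) (\<lambda>v. u v s) powr (1 - \<alpha> / 2))" for s
      using Var_derivative_le[OF V d assms(6-8), of "\<lambda>v. u v s"] by (simp add: mult.commute)
  qed (use assms(6,9) in auto)
qed

end
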